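(* Let $G$ be a connected graph of order $n$ and size $m$ (that is, with $n$ vertices and $m$ edges) with an independent set $U$ of $k$ twin vertices, and let $r$ be the common degree of these vertices. Let $T$ be the transition matrix for the random walk on $G$. Let $\alpha_1$ be the accessibility index in $G$ of one of the twin vertices in $U$. Let $\tilde{T}$ be the transition matrix for the random walk on the graph obtained from $G$ by inserting all possible edges between the vertices of $U$. Then \[\mathcal{K}(\tilde{T}) - \mathcal{K}(T) = \frac{k(k-1)}{2m+k(k-1)}\left(\alpha_1 - \frac{2m(k-1)}{kr}\right) - \frac{k-1}{r+k}.\]
   Context: Graphs are finite, simple and undirected. A set of vertices is a set of twin vertices if pairwise they have the same neighbour set. For a connected graph $G$ with at least one edge, the random walk on $G$ has transition matrix $T=D^{-1}A$, where $A$ is the adjacency matrix and $D$ the diagonal matrix of vertex degrees. For an irreducible row-stochastic matrix $T$ of order $n$ with stationary distribution $w$ (for a graph, $w_i=\deg(v_i)/(2|E(G)|)$), let $m_{i,j}$ ($i\ne j$) be the mean first passage time, i.e. the expected number of steps to reach state $j$ for the first time starting from state $i$. The accessibility index of state $j$ is $\alpha_T(j)=\sum_{i\neq j} w_i m_{i,j}$. Kemeny's constant is $\mathcal{K}(T)=\sum_{j\neq i} w_j m_{i,j}$, which is independent of $i$; equivalently $\mathcal{K}(T)=\sum_{j=2}^n \frac{1}{1-\lambda_j}$, where $1=\lambda_1,\lambda_2,\dots,\lambda_n$ are the eigenvalues of $T$. *)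

theory Defs
  imports "HOL-Probability.Probability"
begin

section \<open>Graphs\<close>

text \<open>
  A graph is given by its edge set; its vertex set is the whole (finite) type, so its order is
  the cardinality of that type.
\<close>

definition simple_graph :: "'v set set \<Rightarrow> bool" where
  "simple_graph E \<longleftrightarrow> (\<forall>e\<in>E. card e = 2)"

definition neighbours :: "'v set set \<Rightarrow> 'v \<Rightarrow> 'v set" where
  "neighbours E v = {u. {v, u} \<in> E}"

definition vertex_degree :: "'v set set \<Rightarrow> 'v \<Rightarrow> nat" where
  "vertex_degree E v = card (neighbours E v)"

definition connected_graph :: "'v set set \<Rightarrow> bool" where
  "connected_graph E \<longleftrightarrow> (\<forall>u v. (u, v) \<in> {(x, y). {x, y} \<in> E}\<^sup>*)"

definition independent_set :: "'v set set \<Rightarrow> 'v set \<Rightarrow> bool" where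
  "independent_set E U \<longleftrightarrow> (\<forall>u\<in>U. \<forall>v\<in>U. {u, v} \<notin> E)"

definition twin_vertices :: "'v set set \<Rightarrow> 'v set \<Rightarrow> bool" where
  "twin_vertices E U \<longleftrightarrow> (\<forall>u\<in>U. \<forall>v\<in>U. neighbours E u = neighbours E v)"

definition insert_all_edges :: "'v set set \<Rightarrow> 'v set \<Rightarrow> 'v set set" where
  "insert_all_edges E U = E \<union> {{u, v} | u v. u \<in> U \<and> v \<in> U \<and> u \<noteq> v}"

definition adjacency_matrix :: "('v::finite) set set \<Rightarrow> real^'v^'v" where
  "adjacency_matrix E = (\<chi> u v. if {u, v} \<in> E then 1 else 0)"

definition degree_matrix :: "('v::finite) set set \<Rightarrow> real^'v^'v" where
  "degree_matrix E = (\<chi> u v. if u = v then real (vertex_degree E u) else 0)"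

definition random_walk :: "('v::finite) set set \<Rightarrow> real^'v^'v" where
  "random_walk E = matrix_inv (degree_matrix E) ** adjacency_matrix E"


section \<open>Finite Markov chains\<close>

definition row_stochastic :: "real^'v^'v::finite \<Rightarrow> bool" where
  "row_stochastic T \<longleftrightarrow> (\<forall>i j. 0 \<le> T $ i $ j) \<and> (\<forall>i. (\<Sum>j\<in>UNIV. T $ i $ j) = 1)"

text \<open>Well defined when \<open>T\<close> is row-stochastic and irreducible.\<close>

definition stationary_distribution :: "real^'v^'v::finite \<Rightarrow> real^'v" where
  "stationary_distribution T =
     (THE w. (\<forall>i. 0 \<le> w $ i) \<and> (\<Sum>i\<in>UNIV. w $ i) = 1 \<and> w v* T = w)"

text \<open>
  The law, on the space of trajectories \<open>\<omega> :: nat \<Rightarrow> 'v\<close>, of the Markov chain with transition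
  matrix \<open>T\<close> started in \<open>i\<close>, built by the Ionescu-Tulcea construction: given the states
  \<open>\<omega> 0, \<dots>, \<omega> (t - 1)\<close>, the distribution of the state at time \<open>t\<close> is \<open>chain_step T i t \<omega>\<close>.
  Lemma \<open>chain_law_cylinder\<close> below computes its finite-dimensional distributions.
\<close>

definition chain_step :: "real^'v^'v::finite \<Rightarrow> 'v \<Rightarrow> nat \<Rightarrow> (nat \<Rightarrow> 'v) \<Rightarrow> 'v measure" where
  "chain_step T i t \<omega> =
     (if t = 0 then return (count_space UNIV) i
      else density (count_space UNIV) (\<lambda>l. ennreal (T $ \<omega> (t - 1) $ l)))"

definition chain_law :: "real^'v^'v::finite \<Rightarrow> 'v \<Rightarrow> (nat \<Rightarrow> 'v) measure" where
  "chain_law T i =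
     projective_family.lim UNIV
       (Ionescu_Tulcea.CI (chain_step T i) (\<lambda>_. count_space UNIV)) (\<lambda>_. count_space UNIV)"

text \<open>The value is \<open>\<infinity>\<close> on trajectories that never reach \<open>j\<close> at a positive time.\<close>

definition first_passage_time :: "'v \<Rightarrow> (nat \<Rightarrow> 'v) \<Rightarrow> ennreal" where
  "first_passage_time j \<omega> = (INF t\<in>{t. 0 < t \<and> \<omega> t = j}. of_nat t)"

text \<open>For irreducible row-stochastic \<open>T\<close> the expectation is finite, so \<open>enn2real\<close> loses nothing.\<close>

definition mean_first_passage_time :: "real^'v^'v::finite \<Rightarrow> 'v \<Rightarrow> 'v \<Rightarrow> real" where
  "mean_first_passage_time T i j =
     enn2real (\<integral>\<^sup>+\<omega>. first_passage_time j \<omega> \<partial>chain_law T i)"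

definition accessibility_index :: "real^'v^'v::finite \<Rightarrow> 'v \<Rightarrow> real" where
  "accessibility_index T j =
     (\<Sum>i\<in>UNIV - {j}. stationary_distribution T $ i * mean_first_passage_time T i j)"

text \<open>
  The sum does not depend on the initial state \<open>i\<close> when \<open>T\<close> is row-stochastic and irreducible;
  Kemeny's constant is its common value.
\<close>

definition kemeny_constant :: "real^'v^'v::finite \<Rightarrow> real" where
  "kemeny_constant T =
     (THE c. \<forall>i. (\<Sum>j\<in>UNIV - {i}. stationary_distribution T $ j * mean_first_passage_time T i j) = c)"


section \<open>Finite-dimensional distributions of the chain\<close>

lemma prob_space_chain_step:
  assumes "row_stochastic T"
  shows "prob_space (chain_step T i t \<omega>)"
proof (cases "t = 0")
  case True
  then show ?thesis
    by (simp add: chain_step_def prob_space_return)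
next
  case False
  have "(\<Sum>l\<in>UNIV. ennreal (T $ \<omega> (t - 1) $ l)) = 1"
    using assms by (subst sum_ennreal) (auto simp: row_stochastic_def)
  with False show ?thesis
    by (auto intro!: prob_spaceI simp: chain_step_def emeasure_density nn_integral_count_space_finite)
qed

lemma Ionescu_Tulcea_chain_step:
  assumes T: "row_stochastic T"
  shows "Ionescu_Tulcea (chain_step T i) (\<lambda>_. count_space UNIV)"
proof (rule Ionescu_Tulcea.intro)
  fix t :: nat
  let ?S = "subprob_algebra (count_space (UNIV :: 'a set))"
  have sub: "prob_space N \<Longrightarrow> sets N = UNIV \<Longrightarrow> N \<in> space ?S" for N :: "'a measure"
    by (auto simp: space_subprob_algebra prob_space_imp_subprob_space)
  have sets: "sets (chain_step T i t \<omega>) = UNIV" for t \<omega>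
    by (simp add: chain_step_def)
  show "chain_step T i t \<in> PiM {0..<t} (\<lambda>_. count_space UNIV) \<rightarrow>\<^sub>M ?S"
  proof (cases "t = 0")
    case True
    then show ?thesis
      using sub[of "return (count_space UNIV) i"]
      by (simp add: chain_step_def[abs_def] prob_space_return)
  next
    case False
    have "(\<lambda>\<omega>. \<omega> (t - 1)) \<in> PiM {0..<t} (\<lambda>_. count_space (UNIV :: 'a set)) \<rightarrow>\<^sub>M count_space UNIV"
      using False by (intro measurable_component_singleton) auto
    moreover have "(\<lambda>s. chain_step T i t (\<lambda>_. s)) \<in> count_space UNIV \<rightarrow>\<^sub>M ?S"
      using sub[OF prob_space_chain_step[OF T] sets] by auto
    ultimately have "(\<lambda>\<omega>. chain_step T i t (\<lambda>_. \<omega> (t - 1)))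
        \<in> PiM {0..<t} (\<lambda>_. count_space UNIV) \<rightarrow>\<^sub>M ?S"
      by (rule measurable_compose)
    then show ?thesis
      by (simp add: chain_step_def[abs_def] cong: if_cong)
  qed
qed (rule prob_space_chain_step[OF T])

lemma chain_law_cylinder:
  assumes T: "row_stochastic T"
  shows "emeasure (chain_law T i) {\<omega>. \<forall>t\<le>n. \<omega> t = x t} =
    (if x 0 = i then \<Prod>t<n. ennreal (T $ x t $ x (Suc t)) else 0)"
proof -
  interpret IT: Ionescu_Tulcea "chain_step T i" "\<lambda>_. count_space UNIV"
    using T by (rule Ionescu_Tulcea_chain_step)
  let ?M = "\<lambda>n. PiM {0..<n} (\<lambda>_. count_space (UNIV :: 'a set))"
  let ?X = "\<lambda>n. PiE {0..<n} (\<lambda>t. {x t})"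
  have X: "?X n \<in> sets (?M n)" for n
    by (intro sets_PiM_I_finite) auto
  have spM: "space (?M n) = PiE {0..<n} (\<lambda>_. UNIV)" for n
    by (simp add: space_PiM)
  have step: "IT.C 0 (Suc m) (\<lambda>_. undefined) (?X (Suc m)) =
      IT.C 0 m (\<lambda>_. undefined) (?X m) * chain_step T i m x {x m}" for m
  proof -
    have "IT.C 0 (Suc m) (\<lambda>_. undefined) (?X (Suc m)) =
        (\<integral>\<^sup>+\<omega>. IT.eP m \<omega> (?X (Suc m)) \<partial>IT.C 0 m (\<lambda>_. undefined))"
      using IT.measurable_eP[of m] X[of "Suc m"]
      by (simp, subst emeasure_bind[where N="?M (Suc m)"])
         (auto simp: IT.space_C spM measurable_cong_sets[OF IT.sets_C refl])
    also have "\<dots> = (\<integral>\<^sup>+\<omega>. chain_step T i m x {x m} * indicator (?X m) \<omega> \<partial>IT.C 0 m (\<lambda>_. undefined))"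
    proof (intro nn_integral_cong)
      fix \<omega> assume "\<omega> \<in> space (IT.C 0 m (\<lambda>_. undefined))"
      then have w: "\<omega> \<in> space (?M m)"
        by (simp add: IT.space_C spM)
      show "IT.eP m \<omega> (?X (Suc m)) = chain_step T i m x {x m} * indicator (?X m) \<omega>"
      proof (cases "\<omega> \<in> ?X m")
        case True
        then have eq: "chain_step T i m \<omega> = chain_step T i m x"
          by (auto simp: chain_step_def PiE_iff)
        have "fun_upd \<omega> m -` ?X (Suc m) = {x m}"
          using True w by (auto simp: PiE_iff extensional_def spM fun_upd_def split: if_splits)
        with True show ?thesis
          using X[of "Suc m"] by (simp add: IT.emeasure_eP[OF w] eq)
      next
        case False
        have "fun_upd \<omega> m -` ?X (Suc m) = {}"
        proof (rule ccontr)
          assume "fun_upd \<omega> m -` ?X (Suc m) \<noteq> {}"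
          then obtain y where y: "fun_upd \<omega> m y \<in> ?X (Suc m)" by auto
          have "\<omega> t = x t" if "t < m" for t
            using PiE_mem[OF y, of t] that by simp
          with w have "\<omega> \<in> ?X m" by (auto simp: PiE_iff spM)
          with False show False ..
        qed
        with False show ?thesis
          using X[of "Suc m"] by (simp add: IT.emeasure_eP[OF w])
      qed
    qed
    also have "\<dots> = IT.C 0 m (\<lambda>_. undefined) (?X m) * chain_step T i m x {x m}"
      using X[of m] by (subst nn_integral_cmult_indicator) (auto simp: IT.sets_C spM mult.commute)
    finally show ?thesis .
  qed
  have C0: "IT.C 0 0 (\<lambda>_. undefined) (?X 0) = 1"
    by (simp add: PiM_empty)
  have s0: "chain_step T i 0 x {x 0} = (if x 0 = i then 1 else 0)"
    by (auto simp: chain_step_def)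
  have sS: "chain_step T i (Suc m) x {x (Suc m)} = ennreal (T $ x m $ x (Suc m))" for m
    by (simp add: chain_step_def emeasure_density nn_integral_count_space_finite)
  have C: "IT.C 0 (Suc n) (\<lambda>_. undefined) (?X (Suc n)) =
      (if x 0 = i then \<Prod>t<n. ennreal (T $ x t $ x (Suc t)) else 0)" for n
  proof (induction n)
    case 0
    then show ?case unfolding step C0 s0 by simp
  next
    case (Suc n)
    then show ?case unfolding step[of "Suc n"] sS by (simp del: IT.C.simps)
  qed
  have "{\<omega>. \<forall>t\<le>n. \<omega> t = x t} = IT.PF.emb UNIV {0..<Suc n} (?X (Suc n))"
    by (auto simp: prod_emb_def PiE_iff)
  then have "emeasure (chain_law T i) {\<omega>. \<forall>t\<le>n. \<omega> t = x t} = IT.CI {0..<Suc n} (?X (Suc n))"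
    unfolding chain_law_def using X[of "Suc n"] by (simp only: IT.lim finite_atLeastLessThan)
  also have "\<dots> = IT.C 0 (Suc n) (\<lambda>_. undefined) (IT.PF.emb {0..<Suc n} {0..<Suc n} (?X (Suc n)))"
    by (intro IT.emeasure_CI X) simp
  also have "IT.PF.emb {0..<Suc n} {0..<Suc n} (?X (Suc n)) = ?X (Suc n)"
    by (rule prod_emb_id) auto
  finally show ?thesis unfolding C .
qed

end

theory Submission
  imports Defs
begin

text \<open>
  Write \<open>L\<close> for the Laplacian, \<open>d\<close> for the degrees, \<open>V = 2m\<close> for their sum, and primes for the graph
  with the additional edges. The mean first passage times \<open>h\<^sub>j\<close> to \<open>j\<close>, with \<open>h\<^sub>j(j) = 0\<close>, form the
  unique solution of \<open>L h\<^sub>j = d - V e\<^sub>j\<close> vanishing at \<open>j\<close>. As \<open>L\<close> and \<open>L'\<close> agree on functions constant on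
  \<open>U\<close>, and \<open>H = \<Sum>\<^sub>v\<^sub>\<in>\<^sub>U h\<^sub>v\<close> satisfies \<open>L H = k d - V 1\<^sub>U\<close>, one gets
  \<open>h'\<^sub>j = (V'/V) h\<^sub>j - ((k - 1)/V) (H - H(j))\<close> for \<open>j\<close> outside \<open>U\<close>. Between distinct twins the passage
  times are \<open>V/r\<close> and \<open>V'/(r + k)\<close>. Kemeny's constant is then computed from a starting state in \<open>U\<close>, the
  self-adjointness of \<open>L\<close> showing that all twins have the same accessibility index.
\<close>

section \<open>Mean first passage times of a finite Markov chain\<close>

lemma sets_chain_law:
  assumes "row_stochastic T"
  shows "sets (chain_law T i) = sets (PiM UNIV (\<lambda>_. count_space UNIV))"
proof -
  interpret IT: Ionescu_Tulcea "chain_step T i" "\<lambda>_. count_space UNIV"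
    using assms by (rule Ionescu_Tulcea_chain_step)
  show ?thesis
    unfolding chain_law_def by (rule IT.PF.sets_lim)
qed

lemma space_chain_law:
  assumes "row_stochastic T"
  shows "space (chain_law T i) = UNIV"
  using sets_eq_imp_space_eq[OF sets_chain_law[OF assms]] by (simp add: space_PiM)

lemma measurable_coordinate_chain_law:
  assumes "row_stochastic T"
  shows "(\<lambda>\<omega>. \<omega> t) \<in> chain_law T i \<rightarrow>\<^sub>M count_space UNIV"
  unfolding measurable_cong_sets[OF sets_chain_law[OF assms] refl]
  by (rule measurable_component_singleton) simp

lemma sets_coordinate_chain_law:
  assumes "row_stochastic T"
  shows "{\<omega>. \<omega> t = l} \<in> sets (chain_law T i)"
  using measurable_sets[OF measurable_coordinate_chain_law[OF assms], of "{l}" t i]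
  by (simp add: space_chain_law[OF assms] vimage_def)

lemma sets_path_chain_law:
  assumes "row_stochastic T"
  shows "{\<omega>. \<forall>t<n. \<omega> (Suc t) \<in> X} \<in> sets (chain_law T i)"
proof -
  have [measurable]: "(\<lambda>\<omega>. \<omega> t) \<in> chain_law T i \<rightarrow>\<^sub>M count_space UNIV" for t
    by (rule measurable_coordinate_chain_law[OF assms])
  have "{\<omega> \<in> space (chain_law T i). \<forall>t<n. \<omega> (Suc t) \<in> X} \<in> sets (chain_law T i)"
    by measurable
  then show ?thesis
    by (simp add: space_chain_law[OF assms])
qed

section \<open>Avoidance probabilities as sums over paths\<close>

primrec path_weight :: "real^'v^'v::finite \<Rightarrow> 'v \<Rightarrow> 'v list \<Rightarrow> ennreal" where
  "path_weight T i [] = 1"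
| "path_weight T i (l # ls) = ennreal (T $ i $ l) * path_weight T l ls"

lemma path_weight_eq_prod:
  "path_weight T i ls = (\<Prod>t<length ls. ennreal (T $ ((i # ls) ! t) $ ((i # ls) ! Suc t)))"
  by (induction ls arbitrary: i) (simp_all add: prod.lessThan_Suc_shift del: prod.lessThan_Suc)

lemma emeasure_chain_law_path:
  assumes "row_stochastic T"
  shows "emeasure (chain_law T i) {\<omega>. \<forall>t\<le>length ls. \<omega> t = (i # ls) ! t} = path_weight T i ls"
  by (simp add: chain_law_cylinder[OF assms] path_weight_eq_prod)

text \<open>Probability that the chain started in \<open>i\<close> avoids \<open>j\<close> at the
  times 1 to \<open>n\<close>, by conditioning on the first step. The start itself is not tested, so
  \<open>i = j\<close> is allowed.\<close>

primrec survival :: "real^'v^'v::finite \<Rightarrow> 'v \<Rightarrow> nat \<Rightarrow> 'v \<Rightarrow> ennreal" where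
  "survival T j 0 i = 1"
| "survival T j (Suc n) i = (\<Sum>l\<in>-{j}. ennreal (T $ i $ l) * survival T j n l)"

lemma survival_eq_sum_paths:
  "survival T j n i = (\<Sum>ls | set ls \<subseteq> -{j} \<and> length ls = n. path_weight T i ls)"
proof (induction n arbitrary: i)
  case 0
  have "{ls. set ls \<subseteq> -{j} \<and> length ls = 0} = {[]}" by auto
  then show ?case by simp
next
  case (Suc n)
  let ?L = "\<lambda>n. {ls. set ls \<subseteq> -{j} \<and> length ls = n}"
  have "(\<Sum>ls\<in>?L (Suc n). path_weight T i ls) =
      (\<Sum>(l, ls)\<in>(-{j}) \<times> ?L n. path_weight T i (l # ls))"
    by (rule sum.reindex_bij_witness[of _ "\<lambda>(l, ls). l # ls" "\<lambda>ls. (hd ls, tl ls)"])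
       (auto simp: length_Suc_conv)
  also have "\<dots> = (\<Sum>l\<in>-{j}. ennreal (T $ i $ l) * (\<Sum>ls\<in>?L n. path_weight T l ls))"
    by (simp add: sum.cartesian_product sum_distrib_left)
  finally show ?case
    by (simp add: Suc.IH)
qed

text \<open>Up to a null set the event is a finite disjoint union of cylinders, one for each path of
  length \<open>n\<close> that avoids \<open>j\<close>, and each cylinder has the weight of its
  path.\<close>

lemma emeasure_survival:
  fixes T :: "real^'v^'v::finite"
  assumes T: "row_stochastic T"
  shows "emeasure (chain_law T i) {\<omega>. \<forall>t<n. \<omega> (Suc t) \<in> -{j}} = survival T j n i"
proof -
  let ?M = "chain_law T i"
  let ?L = "{ls. set ls \<subseteq> -{j} \<and> length ls = n}"
  let ?C = "\<lambda>ls. {\<omega>. \<forall>t\<le>length ls. \<omega> t = (i # ls) ! t}"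
  \<comment> \<open>The cylinders fix the state at time 0, the survival event does not; the almost
    sure start in \<open>i\<close> bridges this. Total mass 1 comes from the cylinder formula at
    time 0.\<close>
  have start: "AE \<omega> in ?M. \<omega> 0 = i"
  proof -
    have UNIV_1: "emeasure ?M (space ?M) = 1"
    proof -
      have "space ?M = (\<Union>l\<in>UNIV. {\<omega>. \<omega> 0 = l})"
        by (auto simp: space_chain_law[OF T])
      also have "emeasure ?M \<dots> = (\<Sum>l\<in>UNIV. emeasure ?M {\<omega>. \<omega> 0 = l})"
        using sets_coordinate_chain_law[OF T]
        by (intro sum_emeasure[symmetric]) (auto simp: disjoint_family_on_def)
      also have "\<dots> = (\<Sum>l\<in>UNIV. if l = i then 1 else 0)"
      proof (rule sum.cong)
        show "emeasure ?M {\<omega>. \<omega> 0 = l} = (if l = i then 1 else 0)" for l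
          using chain_law_cylinder[OF T, of i 0 "\<lambda>_. l"] by simp
      qed simp
      finally show ?thesis by simp
    qed
    then interpret prob_space ?M by (rule prob_spaceI)
    have "emeasure ?M {\<omega>. \<omega> 0 = i} = 1"
      using chain_law_cylinder[OF T, of i 0 "\<lambda>_. i"] by simp
    then have "AE \<omega> in ?M. \<omega> \<in> {\<omega>. \<omega> 0 = i}"
      using prob_eq_1[of "{\<omega>. \<omega> 0 = i}"] sets_coordinate_chain_law[OF T, of 0 i i]
      by (simp add: emeasure_eq_measure)
    then show ?thesis by simp
  qed
  have C_sets: "?C ls \<in> sets ?M" for ls
  proof -
    have "?C ls = (\<Inter>t\<in>{..length ls}. {\<omega>. \<omega> t = (i # ls) ! t})" by auto
    also have "\<dots> \<in> sets ?M"
      using sets_coordinate_chain_law[OF T] by (intro sets.finite_INT) auto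
    finally show ?thesis .
  qed
  have fin: "finite ?L"
    by (rule finite_lists_length_eq) simp
  have split: "{\<omega>. \<omega> 0 = i \<and> (\<forall>t<n. \<omega> (Suc t) \<in> -{j})} = (\<Union>ls\<in>?L. ?C ls)" (is "?A = ?B")
  proof (intro set_eqI iffI)
    fix \<omega> assume w: "\<omega> \<in> ?A"
    define ls where "ls = map (\<lambda>t. \<omega> (Suc t)) [0..<n]"
    have "ls \<in> ?L" "\<omega> \<in> ?C ls"
      using w by (auto simp: ls_def nth_Cons split: nat.split)
    then show "\<omega> \<in> ?B" by blast
  next
    fix \<omega> assume "\<omega> \<in> ?B"
    then obtain ls where ls: "ls \<in> ?L" "\<omega> \<in> ?C ls" by blast
    have "\<omega> 0 = i" using ls(2) by auto
    moreover have "\<omega> (Suc t) \<in> -{j}" if "t < n" for t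
    proof -
      have "\<omega> (Suc t) = ls ! t" using ls that by auto
      then show ?thesis using ls(1) that nth_mem[of t ls] by auto
    qed
    ultimately show "\<omega> \<in> ?A" by simp
  qed
  have disj: "disjoint_family_on ?C ?L"
  proof (clarsimp simp: disjoint_family_on_def)
    fix xs ys :: "'v list" assume xy: "length ys = length xs" "xs \<noteq> ys"
    show "?C xs \<inter> {\<omega>. \<forall>t\<le>length xs. \<omega> t = (i # ys) ! t} = {}"
    proof (rule ccontr)
      assume "\<not> ?thesis"
      then obtain \<omega> where
        "\<forall>t\<le>length xs. \<omega> t = (i # xs) ! t" "\<forall>t\<le>length xs. \<omega> t = (i # ys) ! t" by auto
      then have "(i # xs) ! t = (i # ys) ! t" if "t \<le> length xs" for t
        using that by metis
      then have "xs ! t = ys ! t" if "t < length xs" for t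
        using that by (metis Suc_leI nth_Cons_Suc)
      then show False using xy by (auto simp: list_eq_iff_nth_eq)
    qed
  qed
  have "emeasure ?M {\<omega>. \<forall>t<n. \<omega> (Suc t) \<in> -{j}} = emeasure ?M ?A"
  proof (rule emeasure_eq_AE)
    show "AE \<omega> in ?M. (\<omega> \<in> {\<omega>. \<forall>t<n. \<omega> (Suc t) \<in> -{j}}) = (\<omega> \<in> ?A)"
      using start by eventually_elim simp
    show "?A \<in> sets ?M"
      unfolding split using fin C_sets by (intro sets.finite_UN) auto
  qed (rule sets_path_chain_law[OF T])
  also have "\<dots> = (\<Sum>ls\<in>?L. emeasure ?M (?C ls))"
    unfolding split using fin C_sets disj by (intro sum_emeasure[symmetric]) auto
  also have "\<dots> = survival T j n i"
    by (simp only: survival_eq_sum_paths emeasure_chain_law_path[OF T])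
  finally show ?thesis .
qed

text \<open>A positive integer counts the natural numbers below it, and the first passage is later
  than \<open>n\<close> exactly when the times 1 to \<open>n\<close> avoid \<open>j\<close>. If
  \<open>j\<close> is never reached, both sides are infinite.\<close>

lemma first_passage_time_eq_suminf:
  "first_passage_time j \<omega> = (\<Sum>n. indicator {\<omega>. \<forall>t<n. \<omega> (Suc t) \<in> -{j}} \<omega>)"
proof (cases "\<exists>t. \<omega> (Suc t) = j")
  case True
  define s where "s = (LEAST t. \<omega> (Suc t) = j)"
  have s: "\<omega> (Suc s) = j"
    using True unfolding s_def by (rule LeastI_ex)
  have less: "\<omega> (Suc t) \<noteq> j" if "t < s" for t
    using that not_less_Least unfolding s_def by blast
  have "first_passage_time j \<omega> = of_nat (Suc s)"
    unfolding first_passage_time_def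
  proof (rule antisym)
    show "(INF t\<in>{t. 0 < t \<and> \<omega> t = j}. of_nat t) \<le> (of_nat (Suc s) :: ennreal)"
      using s by (intro INF_lower) auto
    show "(of_nat (Suc s) :: ennreal) \<le> (INF t\<in>{t. 0 < t \<and> \<omega> t = j}. of_nat t)"
    proof (rule INF_greatest)
      fix t assume t: "t \<in> {t. 0 < t \<and> \<omega> t = j}"
      then obtain t' where "t = Suc t'" by (auto simp: gr0_conv_Suc)
      with t less[of t'] have "Suc s \<le> t" by fastforce
      then show "(of_nat (Suc s) :: ennreal) \<le> of_nat t"
        by (rule of_nat_mono)
    qed
  qed
  moreover have "(\<Sum>n. indicator {\<omega>. \<forall>t<n. \<omega> (Suc t) \<in> -{j}} \<omega> :: ennreal) =
      (\<Sum>n\<in>{..s}. indicator {\<omega>. \<forall>t<n. \<omega> (Suc t) \<in> -{j}} \<omega>)"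
    by (rule suminf_finite) (use s in \<open>auto simp: indicator_def not_le\<close>)
  moreover have "\<dots> = (\<Sum>n\<in>{..s}. 1)"
    by (rule sum.cong) (use less in \<open>auto simp: indicator_def\<close>)
  ultimately show ?thesis by simp
next
  case False
  then have "{t. 0 < t \<and> \<omega> t = j} = {}"
    by (auto simp: gr0_conv_Suc)
  moreover have "(\<Sum>n. indicator {\<omega>. \<forall>t<n. \<omega> (Suc t) \<in> -{j}} \<omega> :: ennreal) = (\<Sum>n. 1)"
    using False by (simp add: indicator_def)
  moreover have "(\<Sum>n. 1 :: ennreal) = top"
    by (simp add: nn_integral_count_space_nat[symmetric])
  ultimately show ?thesis
    by (simp add: first_passage_time_def)
qed

lemma nn_integral_first_passage_time:
  assumes T: "row_stochastic T"
  shows "(\<integral>\<^sup>+\<omega>. first_passage_time j \<omega> \<partial>chain_law T i) = (\<Sum>n. survival T j n i)"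
proof -
  have "(\<integral>\<^sup>+\<omega>. first_passage_time j \<omega> \<partial>chain_law T i) =
      (\<Sum>n. \<integral>\<^sup>+\<omega>. indicator {\<omega>. \<forall>t<n. \<omega> (Suc t) \<in> -{j}} \<omega> \<partial>chain_law T i)"
    unfolding first_passage_time_eq_suminf
    by (intro nn_integral_suminf borel_measurable_indicator sets_path_chain_law[OF T])
  also have "\<dots> = (\<Sum>n. survival T j n i)"
    by (simp only: nn_integral_indicator[OF sets_path_chain_law[OF T]] emeasure_survival[OF T])
  finally show ?thesis .
qed

text \<open>
  The existence of a finite solution \<open>h\<close> is what makes the expectations finite: by induction it
  dominates the partial sums of the series of survival probabilities.
\<close>

lemma mean_first_passage_time_eqI:
  fixes T :: "real^'v^'v::finite" and h :: "'v \<Rightarrow> real"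
  assumes T: "row_stochastic T"
    and h_nonneg: "\<And>i. 0 \<le> h i" and h_target: "h j = 0"
    and h_step: "\<And>i. i \<noteq> j \<Longrightarrow> h i = 1 + (\<Sum>l\<in>UNIV. T $ i $ l * h l)"
    and unique: "\<And>y i. y j = 0 \<Longrightarrow> (\<And>i. i \<noteq> j \<Longrightarrow> y i = (\<Sum>l\<in>UNIV. T $ i $ l * y l)) \<Longrightarrow> y i = (0::real)"
    and "i \<noteq> j"
  shows "mean_first_passage_time T i j = h i"
proof -
  define x where "x i = (\<Sum>n. survival T j n i)" for i
  have T_nonneg: "0 \<le> T $ i $ l" for i l
    using T by (simp add: row_stochastic_def)
  have h_step': "ennreal (h i) = 1 + (\<Sum>l\<in>-{j}. ennreal (T $ i $ l) * ennreal (h l))" if "i \<noteq> j" for i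
  proof -
    have "(\<Sum>l\<in>UNIV. T $ i $ l * h l) = (\<Sum>l\<in>-{j}. T $ i $ l * h l)"
      by (rule sum.mono_neutral_right) (auto simp: h_target)
    then have "h i = 1 + (\<Sum>l\<in>-{j}. T $ i $ l * h l)"
      using h_step[OF that] by simp
    moreover have "ennreal (\<Sum>l\<in>-{j}. T $ i $ l * h l) = (\<Sum>l\<in>-{j}. ennreal (T $ i $ l) * ennreal (h l))"
      using T_nonneg h_nonneg by (simp add: sum_ennreal[symmetric] ennreal_mult)
    ultimately show ?thesis
      using T_nonneg h_nonneg by (simp add: ennreal_plus sum_nonneg)
  qed
  have "(\<Sum>n<N. survival T j n i) \<le> ennreal (h i)" if "i \<noteq> j" for N i
    using that
  proof (induction N arbitrary: i)
    case (Suc N)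
    have "(\<Sum>n<Suc N. survival T j n i) =
        1 + (\<Sum>l\<in>-{j}. ennreal (T $ i $ l) * (\<Sum>n<N. survival T j n l))"
      by (simp add: sum.lessThan_Suc_shift sum_distrib_left sum.swap[of _ "{..<N}"]
            del: sum.lessThan_Suc)
    also have "\<dots> \<le> 1 + (\<Sum>l\<in>-{j}. ennreal (T $ i $ l) * ennreal (h l))"
      using Suc.IH by (intro add_left_mono sum_mono mult_left_mono) auto
    finally show ?case
      using h_step'[OF Suc.prems] by simp
  qed simp
  then have x_le: "x i \<le> ennreal (h i)" if "i \<noteq> j" for i
    unfolding x_def suminf_eq_SUP using that by (intro SUP_least)
  have x_fin: "x i = ennreal (enn2real (x i))" if "i \<noteq> j" for i
    using le_less_trans[OF x_le[OF that] ennreal_less_top] by simp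
  have x_step: "x i = 1 + (\<Sum>l\<in>-{j}. ennreal (T $ i $ l) * x l)" for i
  proof -
    have "x i = (\<Sum>n. survival T j (Suc n) i) + (\<Sum>n<1. survival T j n i)"
      unfolding x_def using suminf_offset[of "\<lambda>n. survival T j n i" 1]
      by (simp add: add.commute)
    also have "(\<Sum>n. survival T j (Suc n) i) =
        (\<Sum>l\<in>-{j}. \<Sum>n. ennreal (T $ i $ l) * survival T j n l)"
      by (simp add: suminf_sum)
    finally show ?thesis
      by (simp add: x_def add.commute)
  qed
  \<comment> \<open>The value at \<open>j\<close> is set by hand, since \<open>x j\<close> is the
    mean return time and not 0. Off \<open>j\<close> the terms 1 in the two first-step equations
    cancel, so uniqueness applies to \<open>y\<close>.\<close>
  define y where "y l = (if l = j then 0 else enn2real (x l) - h l)" for l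
  have "y i = 0"
  proof (rule unique)
    show "y j = 0" by (simp add: y_def)
    fix i assume i: "i \<noteq> j"
    have "ennreal (enn2real (x i)) = 1 + (\<Sum>l\<in>-{j}. ennreal (T $ i $ l) * ennreal (enn2real (x l)))"
      unfolding x_fin[OF i, symmetric]
      by (subst x_step, intro arg_cong[where f="(+) 1"] sum.cong) (simp_all flip: x_fin)
    also have "\<dots> = ennreal (1 + (\<Sum>l\<in>-{j}. T $ i $ l * enn2real (x l)))"
      using T_nonneg by (simp add: sum_ennreal[symmetric] ennreal_mult ennreal_plus sum_nonneg)
    finally have "enn2real (x i) = 1 + (\<Sum>l\<in>-{j}. T $ i $ l * enn2real (x l))"
      using T_nonneg by (subst (asm) ennreal_inj) (auto intro!: add_nonneg_nonneg sum_nonneg)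
    moreover have "h i = 1 + (\<Sum>l\<in>-{j}. T $ i $ l * h l)"
      using h_step[OF i] sum.mono_neutral_right[of UNIV "-{j}" "\<lambda>l. T $ i $ l * h l"]
      by (simp add: h_target)
    moreover have "(\<Sum>l\<in>UNIV. T $ i $ l * y l) = (\<Sum>l\<in>-{j}. T $ i $ l * (enn2real (x l) - h l))"
      by (rule sum.mono_neutral_cong_right) (auto simp: y_def)
    ultimately show "y i = (\<Sum>l\<in>UNIV. T $ i $ l * y l)"
      using i by (simp add: y_def right_diff_distrib sum_subtractf)
  qed
  then have "enn2real (x i) = h i"
    using \<open>i \<noteq> j\<close> by (simp add: y_def)
  then show ?thesis
    by (simp add: mean_first_passage_time_def nn_integral_first_passage_time[OF T] x_def)
qed

section \<open>The Laplacian and mean first passage times of a random walk\<close>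

definition laplacian :: "('v::finite) set set \<Rightarrow> ('v \<Rightarrow> real) \<Rightarrow> 'v \<Rightarrow> real" where
  "laplacian E x i = real (vertex_degree E i) * x i - (\<Sum>l\<in>neighbours E i. x l)"

definition total_degree :: "('v::finite) set set \<Rightarrow> real" where
  "total_degree E = (\<Sum>i\<in>UNIV. real (vertex_degree E i))"

text \<open>The target comes first, so that \<open>hitting_time E j\<close> is a function of the
  starting state on which the Laplacian can act. At \<open>j\<close> itself
  \<open>mean_first_passage_time\<close> would give the mean return time instead of the boundary
  value 0.\<close>

definition hitting_time :: "('v::finite) set set \<Rightarrow> 'v \<Rightarrow> 'v \<Rightarrow> real" where
  "hitting_time E j i = (if i = j then 0 else mean_first_passage_time (random_walk E) i j)"

lemma neighbours_sym: "l \<in> neighbours E i \<longleftrightarrow> i \<in> neighbours E l"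
  by (simp add: neighbours_def insert_commute)

lemma laplacian_eq_sum_diff: "laplacian E x i = (\<Sum>l\<in>neighbours E i. x i - x l)"
  by (simp add: laplacian_def vertex_degree_def sum_subtractf)

lemma laplacian_const: "laplacian E (\<lambda>_. c) i = 0"
  by (simp add: laplacian_eq_sum_diff)

lemma laplacian_add: "laplacian E (\<lambda>l. x l + y l) i = laplacian E x i + laplacian E y i"
  by (simp add: laplacian_def sum.distrib algebra_simps)

lemma laplacian_diff: "laplacian E (\<lambda>l. x l - y l) i = laplacian E x i - laplacian E y i"
  by (simp add: laplacian_def sum_subtractf algebra_simps)

lemma laplacian_cmult: "laplacian E (\<lambda>l. c * x l) i = c * laplacian E x i"
  by (simp add: laplacian_def sum_distrib_left[symmetric] algebra_simps)

lemma laplacian_sum: "laplacian E (\<lambda>l. \<Sum>j\<in>J. x j l) i = (\<Sum>j\<in>J. laplacian E (x j) i)"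
  by (simp add: laplacian_def sum_subtractf sum_distrib_left sum.swap[of _ J])

text \<open>Adjacency is symmetric, so the double sum of \<open>y i * x l\<close> over adjacent
  pairs can be taken in either order.\<close>

lemma laplacian_self_adjoint:
  "(\<Sum>i\<in>UNIV. y i * laplacian E x i) = (\<Sum>i\<in>UNIV. laplacian E y i * x i)"
proof -
  have sum_nbr: "(\<Sum>l\<in>neighbours E i. z l) = (\<Sum>l\<in>UNIV. if l \<in> neighbours E i then z l else 0)"
    for z :: "'a \<Rightarrow> real" and i
    by (rule sum.mono_neutral_cong_left) auto
  have "(\<Sum>i\<in>UNIV. y i * (\<Sum>l\<in>neighbours E i. x l)) = (\<Sum>i\<in>UNIV. (\<Sum>l\<in>neighbours E i. y l) * x i)"
    unfolding sum_nbr sum_distrib_left sum_distrib_right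
    by (subst sum.swap) (auto intro!: sum.cong simp: neighbours_sym)
  then show ?thesis
    by (simp add: laplacian_def sum_subtractf left_diff_distrib right_diff_distrib mult_ac)
qed

text \<open>Self-adjointness against the constant 1, whose Laplacian vanishes.\<close>

lemma sum_laplacian: "(\<Sum>i\<in>UNIV. laplacian E x i) = 0"
  using laplacian_self_adjoint[of "\<lambda>_. 1" E x] by (simp add: laplacian_const)

text \<open>Double counting of incidences between vertices and edges.\<close>

lemma total_degree_eq_card:
  assumes "simple_graph E"
  shows "total_degree E = 2 * real (card E)"
proof -
  have deg: "vertex_degree E v = card {e \<in> E. v \<in> e}" for v
    unfolding vertex_degree_def
  proof (rule bij_betw_same_card)
    show "bij_betw (\<lambda>u. {v, u}) (neighbours E v) {e \<in> E. v \<in> e}"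
      unfolding bij_betw_def
    proof (intro conjI set_eqI iffI)
      show "inj_on (\<lambda>u. {v, u}) (neighbours E v)"
        by (auto simp: inj_on_def doubleton_eq_iff)
      fix e assume "e \<in> {e \<in> E. v \<in> e}"
      then have e: "e \<in> E" "v \<in> e" "card e = 2"
        using assms by (auto simp: simple_graph_def)
      then obtain u where "e = {v, u}"
        by (auto simp: card_2_iff)
      with e show "e \<in> (\<lambda>u. {v, u}) ` neighbours E v"
        by (auto simp: neighbours_def)
    qed (auto simp: neighbours_def)
  qed
  have "(\<Sum>v\<in>UNIV. card {e \<in> E. v \<in> e}) = (\<Sum>e\<in>E. card {v \<in> UNIV. v \<in> e})"
    by (rule sum_multicount_gen) auto
  also have "\<dots> = 2 * card E"
    using assms by (simp add: simple_graph_def)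
  finally show ?thesis
    unfolding total_degree_def deg of_nat_sum[symmetric] by simp
qed

section \<open>Connectedness and the maximum principle\<close>

locale connected_simple_graph =
  fixes E :: "('v::finite) set set"
  assumes simple: "simple_graph E" and connected: "connected_graph E" and nonempty: "E \<noteq> {}"
begin

abbreviation deg :: "'v \<Rightarrow> real" where
  "deg i \<equiv> real (vertex_degree E i)"

lemma connected_induct:
  assumes "P u" and "\<And>x y. P x \<Longrightarrow> y \<in> neighbours E x \<Longrightarrow> P y"
  shows "P v"
proof -
  have "(u, v) \<in> {(x, y). {x, y} \<in> E}\<^sup>*"
    using connected by (simp add: connected_graph_def)
  then show ?thesis
    by (induction rule: rtrancl_induct) (use assms in \<open>auto simp: neighbours_def\<close>)
qed

lemma not_in_neighbours_self: "i \<notin> neighbours E i"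
  using simple by (force simp: neighbours_def simple_graph_def)

text \<open>By connectedness a vertex without neighbours would be the only vertex, but some edge has
  two distinct ends.\<close>

lemma deg_pos: "0 < deg i"
proof (rule ccontr)
  assume "\<not> 0 < deg i"
  then have empty: "neighbours E i = {}"
    by (simp add: vertex_degree_def)
  have "v = i" for v
    by (rule connected_induct[of "\<lambda>v. v = i" i]) (use empty in auto)
  moreover obtain e where "e \<in> E" "card e = 2"
    using nonempty simple by (auto simp: simple_graph_def)
  then obtain a b where "a \<noteq> b" "e = {a, b}"
    by (auto simp: card_2_iff)
  ultimately show False by metis
qed

lemma deg_nonzero: "deg i \<noteq> 0"
  using deg_pos[of i] by linarith

lemma total_degree_pos: "0 < total_degree E"
  unfolding total_degree_def using deg_pos by (intro sum_pos) auto

text \<open>Maximum principle: the set of maximisers is closed under taking neighbours.\<close>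

lemma laplacian_zero_imp_const:
  assumes zero: "\<And>i. laplacian E x i = 0"
  shows "x i = x j"
proof -
  have "\<exists>a. \<forall>l. x l \<le> x a"
  proof -
    have "Max (range x) \<in> range x" by (intro Max_in) auto
    then obtain a where "Max (range x) = x a" by blast
    then have "x l \<le> x a" for l
      using Max_ge[of "range x" "x l"] by simp
    then show ?thesis by blast
  qed
  then obtain a where a: "\<And>l. x l \<le> x a" by blast
  have "x v = x a" for v
  proof (rule connected_induct[of "\<lambda>v. x v = x a" a])
    fix b c assume b: "x b = x a" and c: "c \<in> neighbours E b"
    have "(\<Sum>l\<in>neighbours E b. x b - x l) = 0"
      using zero[of b] by (simp add: laplacian_eq_sum_diff)
    then have "x b - x c = 0"
      using c a b by (subst (asm) sum_nonneg_eq_0_iff) auto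
    with b show "x c = x a" by simp
  qed simp
  then show ?thesis by metis
qed

text \<open>A Laplacian sums to 0, so vanishing off \<open>j\<close> forces vanishing at
  \<open>j\<close>. Then \<open>y\<close> is constant, hence equal to its value 0 at
  \<open>j\<close>.\<close>

lemma dirichlet_unique:
  assumes "y j = 0" and off: "\<And>i. i \<noteq> j \<Longrightarrow> laplacian E y i = 0"
  shows "y i = 0"
proof -
  have "(\<Sum>i\<in>UNIV. laplacian E y i) = laplacian E y j"
    using off by (subst sum.remove[of _ j]) auto
  then have "laplacian E y i = 0" for i
    using off[of i] sum_laplacian[of E y] by (cases "i = j") auto
  then show ?thesis
    using laplacian_zero_imp_const[of y i j] \<open>y j = 0\<close> by simp
qed

section \<open>Transition matrix and stationary distribution\<close>

lemma random_walk_component: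
  "random_walk E $ i $ l = (if l \<in> neighbours E i then 1 / deg i else 0)"
proof -
  let ?D = "degree_matrix E" and ?A = "adjacency_matrix E"
  let ?B = "(\<chi> u v. if u = v then 1 / deg u else 0) :: real^'v^'v"
  have diag: "(\<chi> u v. if u = v then f u else 0) ** (\<chi> u v. if u = v then g u else 0) =
      ((\<chi> u v. if u = v then f u * g u else 0) :: real^'v^'v)" for f g :: "'v \<Rightarrow> real"
    by (simp add: matrix_matrix_mult_def vec_eq_iff mult_delta_left)
  have "?D ** ?B = mat 1" "?B ** ?D = mat 1"
    unfolding degree_matrix_def diag using deg_pos by (simp_all add: mat_def vec_eq_iff)
  \<comment> \<open>\<open>matrix_inv\<close> is given by choice, so a concrete two-sided inverse
    \<open>?B\<close> had to be exhibited first. The entries are then read off from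
    \<open>?D ** random_walk E = ?A\<close>.\<close>
  then have "?D ** matrix_inv ?D = mat 1"
    unfolding matrix_inv_def by (rule someI2[of _ ?B, OF conjI]) simp
  then have "?D ** random_walk E = ?A"
    by (simp add: random_walk_def matrix_mul_assoc)
  then have "(?D ** random_walk E) $ i $ l = ?A $ i $ l" by simp
  then have "deg i * random_walk E $ i $ l = (if {i, l} \<in> E then 1 else 0)"
    by (simp add: matrix_matrix_mult_def degree_matrix_def adjacency_matrix_def
          mult_delta_left)
  then show ?thesis
    using deg_pos[of i] by (auto simp: neighbours_def field_simps)
qed

lemma sum_random_walk:
  "(\<Sum>l\<in>UNIV. random_walk E $ i $ l * x l) = (\<Sum>l\<in>neighbours E i. x l) / deg i"
proof -
  have "(\<Sum>l\<in>UNIV. random_walk E $ i $ l * x l) = (\<Sum>l\<in>neighbours E i. x l / deg i)"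
    by (rule sum.mono_neutral_cong_right) (auto simp: random_walk_component)
  then show ?thesis by (simp add: sum_divide_distrib)
qed

lemma row_stochastic_random_walk: "row_stochastic (random_walk E)"
  unfolding row_stochastic_def
proof (intro conjI allI)
  show "0 \<le> random_walk E $ i $ j" for i j
    using deg_pos[of i] by (simp add: random_walk_component)
  show "(\<Sum>j\<in>UNIV. random_walk E $ i $ j) = 1" for i
    using sum_random_walk[of i "\<lambda>_. 1"] deg_pos[of i]
    by (simp add: vertex_degree_def card_gt_0_iff)
qed

text \<open>By symmetry of adjacency, \<open>w v* random_walk E\<close> at \<open>i\<close> sums
  \<open>w $ l / deg l\<close> over the neighbours \<open>l\<close> of \<open>i\<close>. The maximum
  principle thereby gives uniqueness of the stationary distribution.\<close>

lemma invariant_iff_laplacian: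
  "w v* random_walk E = w \<longleftrightarrow> (\<forall>i. laplacian E (\<lambda>l. w $ l / deg l) i = 0)"
proof -
  have "(w v* random_walk E) $ i = (\<Sum>l\<in>neighbours E i. w $ l / deg l)" for i
    unfolding vector_matrix_mult_def vec_lambda_beta
    by (rule sum.mono_neutral_cong_right)
       (auto simp: random_walk_component neighbours_sym[of i])
  moreover have "laplacian E (\<lambda>l. w $ l / deg l) i = w $ i - (\<Sum>l\<in>neighbours E i. w $ l / deg l)" for i
    using deg_nonzero by (simp add: laplacian_def)
  ultimately have "(w v* random_walk E) $ i = w $ i \<longleftrightarrow> laplacian E (\<lambda>l. w $ l / deg l) i = 0" for i
    by auto
  then show ?thesis
    by (simp add: vec_eq_iff)
qed

lemma stationary_distribution_component:
  "stationary_distribution (random_walk E) $ i = deg i / total_degree E"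
proof -
  let ?w = "(\<chi> i. deg i / total_degree E) :: real^'v"
  have "stationary_distribution (random_walk E) = ?w"
    unfolding stationary_distribution_def
  proof (rule the_equality, intro conjI allI)
    show "0 \<le> ?w $ i" for i
      using total_degree_pos by simp
    show "(\<Sum>i\<in>UNIV. ?w $ i) = 1"
      using total_degree_pos by (simp add: sum_divide_distrib[symmetric] total_degree_def)
    show "?w v* random_walk E = ?w"
      unfolding invariant_iff_laplacian using deg_nonzero by (simp add: laplacian_const)
  next
    fix w :: "real^'v"
    assume w: "(\<forall>i. 0 \<le> w $ i) \<and> (\<Sum>i\<in>UNIV. w $ i) = 1 \<and> w v* random_walk E = w"
    obtain c where c: "\<And>i. w $ i / deg i = c"
      using laplacian_zero_imp_const[of "\<lambda>l. w $ l / deg l"] w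
      unfolding invariant_iff_laplacian by metis
    then have w_c: "w $ i = c * deg i" for i
      using c[of i] deg_pos[of i] by (simp add: divide_eq_eq)
    then have "1 = c * total_degree E"
      using w by (simp add: total_degree_def sum_distrib_left)
    then show "w = ?w"
      using total_degree_pos by (auto simp: vec_eq_iff w_c field_simps)
  qed
  then show ?thesis by simp
qed

section \<open>Hitting times as solutions of a Dirichlet problem\<close>

lemma dirichlet_exists: "\<exists>h. h j = 0 \<and> (\<forall>i. i \<noteq> j \<longrightarrow> laplacian E h i = f i)"
proof -
  \<comment> \<open>The row of the Laplacian at \<open>j\<close> is replaced by evaluation at
    \<open>j\<close>, which encodes the boundary value. \<open>dirichlet_unique\<close> makes
    \<open>M\<close> injective, hence surjective by finite dimension.\<close>
  define M :: "real^'v \<Rightarrow> real^'v" where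
    "M x = (\<chi> i. if i = j then x $ j else laplacian E (($) x) i)" for x
  have lin: "linear M"
  proof -
    have "($) (x + y) = (\<lambda>l. x $ l + y $ l)" "($) (c *\<^sub>R x) = (\<lambda>l. c * x $ l)"
      for x y :: "real^'v" and c
      by (simp_all add: fun_eq_iff)
    then show ?thesis
      by (intro linearI) (simp_all add: M_def vec_eq_iff laplacian_add laplacian_cmult)
  qed
  have "x = 0" if "M x = 0" for x
  proof -
    have "x $ j = 0" "\<And>i. i \<noteq> j \<Longrightarrow> laplacian E (($) x) i = 0"
      using that by (auto simp: M_def vec_eq_iff split: if_splits)
    then have "x $ i = 0" for i
      by (rule dirichlet_unique)
    then show ?thesis by (simp add: vec_eq_iff)
  qed
  then have "inj M"
    using lin by (simp add: linear_injective_0)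
  with lin have "surj M"
    by (rule linear_injective_imp_surjective) simp
  then obtain x where "M x = (\<chi> i. if i = j then 0 else f i)"
    by (metis surjD)
  then have "x $ j = 0 \<and> (\<forall>i. i \<noteq> j \<longrightarrow> laplacian E (($) x) i = f i)"
    by (auto simp: M_def vec_eq_iff split: if_splits)
  then show ?thesis by blast
qed

text \<open>Divided by the degree, the equation at \<open>i\<close> is the first-step equation of
  the chain. At a minimiser the Laplacian is at most 0, while off \<open>j\<close> it is positive;
  so the minimum is attained at \<open>j\<close> and \<open>h\<close> is nonnegative.\<close>

lemma hitting_time_eqI:
  assumes h_target: "h j = 0" and h_off: "\<And>i. i \<noteq> j \<Longrightarrow> laplacian E h i = deg i"
  shows "hitting_time E j = h"
proof
  have "\<exists>a. \<forall>l. h a \<le> h l"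
  proof -
    have "Min (range h) \<in> range h" by (intro Min_in) auto
    then obtain a where "Min (range h) = h a" by blast
    then have "h a \<le> h l" for l
      using Min_le[of "range h" "h l"] by simp
    then show ?thesis by blast
  qed
  then obtain a where a: "\<And>l. h a \<le> h l" by blast
  have "laplacian E h a \<le> 0"
    unfolding laplacian_eq_sum_diff using a by (intro sum_nonpos) simp
  then have "a = j"
    using h_off[of a] deg_pos[of a] by fastforce
  with a h_target have h_nonneg: "0 \<le> h l" for l by metis
  fix i
  show "hitting_time E j i = h i"
  proof (cases "i = j")
    case False
    have "mean_first_passage_time (random_walk E) i j = h i"
    proof (rule mean_first_passage_time_eqI[of _ h, OF row_stochastic_random_walk h_nonneg h_target])
      show "h i = 1 + (\<Sum>l\<in>UNIV. random_walk E $ i $ l * h l)" if "i \<noteq> j" for i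
        using h_off[OF that] deg_pos[of i] unfolding sum_random_walk
        by (simp add: laplacian_def field_simps)
    next
      fix y :: "'v \<Rightarrow> real" and i
      assume y: "y j = 0" "\<And>i. i \<noteq> j \<Longrightarrow> y i = (\<Sum>l\<in>UNIV. random_walk E $ i $ l * y l)"
      have "laplacian E y i = 0" if "i \<noteq> j" for i
        using y(2)[OF that] deg_pos[of i] unfolding sum_random_walk
        by (simp add: laplacian_def field_simps)
      with y(1) show "y i = 0" by (rule dirichlet_unique)
    qed (use False in simp)
    with False show ?thesis
      by (simp add: hitting_time_def)
  qed (simp add: hitting_time_def h_target)
qed

lemma hitting_time_target [simp]: "hitting_time E j j = 0"
  by (simp add: hitting_time_def)

text \<open>The value at the target is forced by the fact that a Laplacian sums to 0.\<close>

lemma laplacian_hitting_time: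
  "laplacian E (hitting_time E j) i = deg i - (if i = j then total_degree E else 0)"
proof -
  obtain h where h: "h j = 0" "\<And>i. i \<noteq> j \<Longrightarrow> laplacian E h i = deg i"
    using dirichlet_exists[of j deg] by blast
  then have off: "laplacian E (hitting_time E j) i = deg i" if "i \<noteq> j" for i
    using hitting_time_eqI[of h j] that by simp
  moreover have "(\<Sum>i\<in>UNIV - {j}. laplacian E (hitting_time E j) i) = (\<Sum>i\<in>UNIV - {j}. deg i)"
    using off by (intro sum.cong) auto
  then have "laplacian E (hitting_time E j) j = deg j - total_degree E"
    using sum_laplacian[of E "hitting_time E j"] by (simp add: total_degree_def sum.remove[of _ j])
  ultimately show ?thesis by simp
qed

section \<open>Accessibility index and Kemeny's constant\<close>

lemma accessibility_index_eq:
  "accessibility_index (random_walk E) j = (\<Sum>i\<in>UNIV. deg i * hitting_time E j i) / total_degree E"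
proof -
  have "(\<Sum>i\<in>UNIV. deg i * hitting_time E j i) = (\<Sum>i\<in>UNIV - {j}. deg i * hitting_time E j i)"
    by (simp add: sum.remove[of _ j])
  then show ?thesis
    by (simp add: accessibility_index_def stationary_distribution_component hitting_time_def
          sum_divide_distrib)
qed

text \<open>In the Laplacian of \<open>?F\<close> at \<open>i\<close>, the sum of
  \<open>deg j * deg i\<close> over \<open>j\<close> equals \<open>deg i * total_degree E\<close>
  and cancels the term from the target \<open>i\<close>. So \<open>?F\<close> is constant, which
  makes the description in \<open>kemeny_constant\<close> definite.\<close>

lemma kemeny_constant_eq:
  "kemeny_constant (random_walk E) = (\<Sum>j\<in>UNIV. deg j * hitting_time E j i) / total_degree E"
proof -
  let ?F = "\<lambda>i. \<Sum>j\<in>UNIV. deg j * hitting_time E j i"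
  have "laplacian E ?F i = 0" for i
  proof -
    have "laplacian E ?F i = (\<Sum>j\<in>UNIV. deg j * deg i - (if j = i then deg j * total_degree E else 0))"
      unfolding laplacian_sum
      by (auto intro!: sum.cong simp: laplacian_cmult laplacian_hitting_time right_diff_distrib)
    also have "\<dots> = 0"
      by (simp add: sum_subtractf sum_distrib_right[symmetric] total_degree_def)
    finally show ?thesis .
  qed
  then have const: "?F l = ?F i" for l
    by (rule laplacian_zero_imp_const)
  have "(\<Sum>j\<in>UNIV - {l}. stationary_distribution (random_walk E) $ j *
      mean_first_passage_time (random_walk E) l j) = ?F i / total_degree E" for l
  proof -
    have "?F l = (\<Sum>j\<in>UNIV - {l}. deg j * hitting_time E j l)"
      by (simp add: sum.remove[of _ l])
    then show ?thesis
      unfolding const[of l, symmetric]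
      by (simp add: stationary_distribution_component hitting_time_def sum_divide_distrib)
  qed
  then show ?thesis
    unfolding kemeny_constant_def by simp
qed

text \<open>Pairing \<open>hitting_time E a\<close> with the Laplacian of
  \<open>hitting_time E b\<close> gives \<open>total_degree E\<close> times the index of
  \<open>a\<close> minus \<open>hitting_time E a b\<close>. Self-adjointness exchanges
  \<open>a\<close> and \<open>b\<close>.\<close>

lemma accessibility_index_diff:
  "accessibility_index (random_walk E) a - accessibility_index (random_walk E) b =
    hitting_time E a b - hitting_time E b a"
proof -
  have "(\<Sum>i\<in>UNIV. hitting_time E x i * laplacian E (hitting_time E y) i) =
      (\<Sum>i\<in>UNIV. deg i * hitting_time E x i) - total_degree E * hitting_time E x y" for x y
    by (simp add: laplacian_hitting_time right_diff_distrib sum_subtractf mult.commute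
          if_distrib[of "(*) _"] cong: if_cong)
  from this[of a b] this[of b a]
  have "(\<Sum>i\<in>UNIV. deg i * hitting_time E a i) - total_degree E * hitting_time E a b =
      (\<Sum>i\<in>UNIV. deg i * hitting_time E b i) - total_degree E * hitting_time E b a"
    using laplacian_self_adjoint[of "hitting_time E a" E "hitting_time E b"]
    by (simp add: mult.commute)
  then show ?thesis
    using total_degree_pos by (simp add: accessibility_index_eq field_simps)
qed

end

section \<open>Twin vertices\<close>

locale twin_set = connected_simple_graph +
  fixes U :: "'a set" and r :: nat
  assumes independent: "independent_set E U" and twins: "twin_vertices E U"
    and degree_U: "\<And>v. v \<in> U \<Longrightarrow> vertex_degree E v = r" and U_nonempty: "U \<noteq> {}"
begin

abbreviation "E' \<equiv> insert_all_edges E U"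
abbreviation "H \<equiv> \<lambda>i. \<Sum>v\<in>U. hitting_time E v i"

lemma r_pos: "0 < real r"
  using U_nonempty degree_U deg_pos by (metis all_not_in_conv)

lemma neighbours_U: "a \<in> U \<Longrightarrow> b \<in> U \<Longrightarrow> neighbours E a = neighbours E b"
  using twins unfolding twin_vertices_def by blast

section \<open>Degrees and Laplacian of the enlarged graph\<close>

lemma neighbours_insert_all_edges:
  "neighbours E' i = neighbours E i \<union> (if i \<in> U then U - {i} else {})"
  by (auto simp: neighbours_def insert_all_edges_def doubleton_eq_iff)

lemma neighbours_disjoint_U: "i \<in> U \<Longrightarrow> neighbours E i \<inter> U = {}"
  using independent by (auto simp: neighbours_def independent_set_def)

lemma degree_insert_all_edges:
  "real (vertex_degree E' i) = deg i + (if i \<in> U then real (card U) - 1 else 0)"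
proof (cases "i \<in> U")
  case True
  then have "1 \<le> card U" by (simp add: Suc_le_eq card_gt_0_iff) blast
  moreover have "card (neighbours E i \<union> (U - {i})) = card (neighbours E i) + card (U - {i})"
    using neighbours_disjoint_U[OF True] by (intro card_Un_disjoint) auto
  ultimately show ?thesis
    using True by (simp add: vertex_degree_def neighbours_insert_all_edges of_nat_diff)
qed (simp add: vertex_degree_def neighbours_insert_all_edges)

lemma total_degree_insert_all_edges:
  "total_degree E' = total_degree E + real (card U) * (real (card U) - 1)"
  by (simp add: total_degree_def degree_insert_all_edges sum.distrib sum.If_cases)

text \<open>The added term is the Laplacian of the complete graph on \<open>U\<close>; it vanishes
  on functions constant on \<open>U\<close>.\<close>

lemma laplacian_insert_all_edges:
  "laplacian E' x i =
    laplacian E x i + (if i \<in> U then real (card U) * x i - (\<Sum>v\<in>U. x v) else 0)"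
proof (cases "i \<in> U")
  case True
  have "(\<Sum>l\<in>neighbours E i \<union> (U - {i}). x i - x l) =
      (\<Sum>l\<in>neighbours E i. x i - x l) + (\<Sum>l\<in>U - {i}. x i - x l)"
    using neighbours_disjoint_U[OF True] by (intro sum.union_disjoint) auto
  moreover have "(\<Sum>l\<in>U. x i - x l) = (\<Sum>l\<in>U - {i}. x i - x l)"
    using True by (simp add: sum.remove[of U i])
  ultimately show ?thesis
    using True by (simp add: laplacian_eq_sum_diff neighbours_insert_all_edges sum_subtractf)
qed (simp add: laplacian_eq_sum_diff neighbours_insert_all_edges)

sublocale cliqued: connected_simple_graph E'
proof
  show "simple_graph E'"
    using simple by (auto simp: simple_graph_def insert_all_edges_def)
  have "{(x, y). {x, y} \<in> E}\<^sup>* \<subseteq> {(x, y). {x, y} \<in> E'}\<^sup>*"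
    by (intro rtrancl_mono) (auto simp: insert_all_edges_def)
  then show "connected_graph E'"
    using connected by (auto simp: connected_graph_def)
  show "E' \<noteq> {}"
    using nonempty by (simp add: insert_all_edges_def)
qed

section \<open>Hitting times from a twin vertex\<close>

lemma hitting_time_const_on_U:
  assumes "j \<notin> U" "a \<in> U" "b \<in> U"
  shows "hitting_time E j a = hitting_time E j b"
proof -
  have "a \<noteq> j" "b \<noteq> j" using assms by auto
  \<comment> \<open>The Laplace equations at \<open>a\<close> and \<open>b\<close> have the same
    right-hand side and the same neighbour sum.\<close>
  then have "real r * hitting_time E j a - (\<Sum>l\<in>neighbours E b. hitting_time E j l) =
      real r * hitting_time E j b - (\<Sum>l\<in>neighbours E b. hitting_time E j l)"
    using laplacian_hitting_time[of j a] laplacian_hitting_time[of j b] assms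
    by (simp only: laplacian_def degree_U neighbours_U[of a b] if_False)
  then show ?thesis using r_pos by simp
qed

text \<open>In the difference of the Laplace equations at \<open>a\<close> and at the target
  \<open>b\<close>, the neighbour sums and the degrees cancel.\<close>

lemma hitting_time_between_twins:
  assumes "a \<in> U" "b \<in> U" "a \<noteq> b"
  shows "hitting_time E b a = total_degree E / real r"
proof -
  have "real r * hitting_time E b a = total_degree E"
    using laplacian_hitting_time[of b a] laplacian_hitting_time[of b b] assms
    by (simp add: laplacian_def degree_U neighbours_U[of a b])
  then show ?thesis using r_pos by (simp add: field_simps)
qed

text \<open>The same subtraction in the enlarged graph. The clique term subtracts the sum over all
  of \<open>U\<close>, the vertex itself included, which is common to both equations; so the
  coefficient is one more than the new degree.\<close>

lemma hitting_time_between_cliqued_twins: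
  assumes "a \<in> U" "b \<in> U" "a \<noteq> b"
  shows "hitting_time E' b a = total_degree E' / (real r + real (card U))"
proof -
  have "(real r + real (card U)) * hitting_time E' b a = total_degree E'"
    using cliqued.laplacian_hitting_time[of b a] cliqued.laplacian_hitting_time[of b b] assms
    unfolding laplacian_insert_all_edges degree_insert_all_edges
    by (simp add: laplacian_def degree_U neighbours_U[of a b] algebra_simps)
  then show ?thesis using r_pos by (simp add: field_simps)
qed

text \<open>The value does not involve \<open>a\<close>, so \<open>H\<close> is constant on
  \<open>U\<close>. The target \<open>a\<close> contributes 0, hence the factor
  \<open>card U - 1\<close>.\<close>

lemma sum_hitting_time_U:
  assumes "a \<in> U"
  shows "H a = (real (card U) - 1) * total_degree E / real r"
proof -
  have "H a = (\<Sum>v\<in>U - {a}. total_degree E / real r)"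
    using assms hitting_time_between_twins
    by (subst sum.remove[of U a], simp, simp, simp only: hitting_time_target add_0)
       (rule sum.cong, auto)
  moreover have "1 \<le> card U"
    using assms by (simp add: Suc_le_eq card_gt_0_iff) blast
  ultimately show ?thesis
    using assms by (simp add: of_nat_diff)
qed

lemma laplacian_sum_hitting_time:
  "laplacian E H i = real (card U) * deg i - (if i \<in> U then total_degree E else 0)"
  by (simp add: laplacian_sum laplacian_hitting_time sum_subtractf)

text \<open>
  All functions on the right-hand side are constant on \<open>U\<close>, so the new edges do not contribute to
  their Laplacian; \<open>H\<close> corrects for the increase of the degrees on \<open>U\<close>.
\<close>

lemma hitting_time_insert_all_edges:
  assumes "j \<notin> U"
  shows "hitting_time E' j i = total_degree E' / total_degree E * hitting_time E j i
    - (real (card U) - 1) / total_degree E * (H i - H j)"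
proof -
  \<comment> \<open>With this \<open>c\<close>,
    \<open>total_degree E' / total_degree E - c * card U\<close> is 1, which reproduces the degrees
    off \<open>U\<close>; on \<open>U\<close> the remaining \<open>c * total_degree E\<close> is the
    increase \<open>card U - 1\<close>. Subtracting \<open>H j\<close> gives the boundary value
    0.\<close>
  define c where "c = (real (card U) - 1) / total_degree E"
  let ?g = "\<lambda>i. total_degree E' / total_degree E * hitting_time E j i - c * (H i - H j)"
  have "hitting_time E' j = ?g"
  proof (rule cliqued.hitting_time_eqI)
    fix i assume i: "i \<noteq> j"
    have const: "?g a = ?g b" if "a \<in> U" "b \<in> U" for a b
      using hitting_time_const_on_U[OF assms that] that by (simp add: sum_hitting_time_U)
    have "real (card U) * ?g i - (\<Sum>v\<in>U. ?g v) = 0" if "i \<in> U"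
    proof -
      have "(\<Sum>v\<in>U. ?g v) = (\<Sum>v\<in>U. ?g i)"
        by (intro sum.cong refl const that)
      then show ?thesis by simp
    qed
    then have "laplacian E' ?g i = laplacian E ?g i"
      unfolding laplacian_insert_all_edges by simp
    also have "\<dots> = total_degree E' / total_degree E * deg i - c * (real (card U) * deg i - (if i \<in> U then total_degree E else 0))"
      unfolding laplacian_diff laplacian_cmult laplacian_const laplacian_hitting_time
        laplacian_sum_hitting_time using i by simp
    also have "\<dots> = real (vertex_degree E' i)"
      using total_degree_pos unfolding degree_insert_all_edges total_degree_insert_all_edges c_def
      by (auto simp: field_simps)
    finally show "laplacian E' ?g i = real (vertex_degree E' i)" .
  qed simp
  then show ?thesis by (simp add: c_def)
qed

text \<open>Both constants are split into targets in \<open>U\<close>, with explicit hitting times,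
  and targets outside \<open>U\<close>, where \<open>hitting_time_insert_all_edges\<close> compares
  the graphs. The accessibility index enters through the degree-weighted sum of
  \<open>H\<close>.\<close>

lemma kemeny_constant_insert_all_edges:
  assumes u: "u \<in> U"
  defines "k \<equiv> real (card U)"
  shows "kemeny_constant (random_walk E') - kemeny_constant (random_walk E) =
    k * (k - 1) / total_degree E' *
      (accessibility_index (random_walk E) u - total_degree E * (k - 1) / (k * real r))
    - (k - 1) / (real r + k)"
proof -
  let ?V = "total_degree E" and ?V' = "total_degree E'"
  define \<alpha> where "\<alpha> = accessibility_index (random_walk E) u"
  have k_ge_1: "1 \<le> k"
    using u unfolding k_def by (simp add: Suc_le_eq card_gt_0_iff) blast
  have card_diff: "real (card (U - {u})) = k - 1"
    using u k_ge_1 by (simp add: k_def of_nat_diff)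
  have split: "sum f UNIV = sum f U + sum f (-U)" for f :: "'a \<Rightarrow> real"
    using sum.union_disjoint[of U "-U" f] by (simp add: Compl_partition)
  have K: "?V * kemeny_constant (random_walk E) = (k - 1) * ?V + (\<Sum>j\<in>-U. deg j * hitting_time E j u)"
  proof -
    have "(\<Sum>j\<in>U. deg j * hitting_time E j u) = (\<Sum>j\<in>U - {u}. ?V)"
      using u r_pos hitting_time_between_twins degree_U
      by (subst sum.remove[of U u], simp, simp, simp only: hitting_time_target mult_zero_right add_0)
         (rule sum.cong, auto)
    then show ?thesis
      using total_degree_pos by (simp add: kemeny_constant_eq[of u] split card_diff)
  qed
  have K': "?V' * kemeny_constant (random_walk E') =
      (k - 1) * (real r + k - 1) * ?V' / (real r + k) + (\<Sum>j\<in>-U. deg j * hitting_time E' j u)"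
  proof -
    have "(\<Sum>j\<in>U. real (vertex_degree E' j) * hitting_time E' j u) =
        (\<Sum>j\<in>U - {u}. (real r + k - 1) * (?V' / (real r + k)))"
      using u hitting_time_between_cliqued_twins degree_U
      by (subst sum.remove[of U u], simp, simp, simp only: cliqued.hitting_time_target mult_zero_right add_0)
         (rule sum.cong, auto simp: degree_insert_all_edges k_def)
    moreover have "(\<Sum>j\<in>-U. real (vertex_degree E' j) * hitting_time E' j u) =
        (\<Sum>j\<in>-U. deg j * hitting_time E' j u)"
      by (intro sum.cong) (auto simp: degree_insert_all_edges)
    ultimately show ?thesis
      using cliqued.total_degree_pos by (simp add: cliqued.kemeny_constant_eq[of u] split card_diff)
  qed
  \<comment> \<open>Exchanging the sums produces the accessibility indices of the twins, which agree
    because hitting times between twins are symmetric.\<close>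
  have "(\<Sum>j\<in>UNIV. deg j * H j) = (\<Sum>v\<in>U. ?V * accessibility_index (random_walk E) v)"
    using total_degree_pos unfolding accessibility_index_eq sum_distrib_left
    by (subst sum.swap) (simp flip: sum_distrib_left)
  also have "\<dots> = (\<Sum>v\<in>U. ?V * \<alpha>)"
  proof (rule sum.cong)
    fix v assume v: "v \<in> U"
    have "hitting_time E u v = hitting_time E v u"
      using u v hitting_time_between_twins by (cases "u = v") auto
    then show "?V * accessibility_index (random_walk E) v = ?V * \<alpha>"
      using accessibility_index_diff[of u v] by (simp add: \<alpha>_def)
  qed simp
  also have "\<dots> = k * ?V * \<alpha>"
    by (simp add: k_def)
  \<comment> \<open>The part over \<open>U\<close> that is removed consists of \<open>k\<close>
    equal terms \<open>real r * ((k - 1) * ?V / real r)\<close>.\<close>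
  finally have "(\<Sum>j\<in>-U. deg j * H j) = k * ?V * \<alpha> - k * (k - 1) * ?V"
    using r_pos by (simp add: split sum_hitting_time_U degree_U k_def)
  moreover have "(\<Sum>j\<in>-U. deg j) = ?V - k * real r"
    using split[of deg] by (simp add: total_degree_def degree_U k_def)
  moreover have "(\<Sum>j\<in>-U. deg j * (H u - H j)) = (\<Sum>j\<in>-U. deg j) * H u - (\<Sum>j\<in>-U. deg j * H j)"
    by (simp only: right_diff_distrib sum_subtractf sum_distrib_right)
  ultimately have HH: "(\<Sum>j\<in>-U. deg j * (H u - H j)) =
      (?V - k * real r) * ((k - 1) * ?V / real r) - (k * ?V * \<alpha> - k * (k - 1) * ?V)"
    using u by (simp add: sum_hitting_time_U k_def)
  have "(\<Sum>j\<in>-U. deg j * hitting_time E' j u) =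
      (\<Sum>j\<in>-U. ?V' / ?V * (deg j * hitting_time E j u) - (k - 1) / ?V * (deg j * (H u - H j)))"
    by (intro sum.cong) (auto simp: hitting_time_insert_all_edges k_def algebra_simps)
  also have "\<dots> = ?V' / ?V * (\<Sum>j\<in>-U. deg j * hitting_time E j u)
      - (k - 1) / ?V * (\<Sum>j\<in>-U. deg j * (H u - H j))"
    by (simp only: sum_subtractf sum_distrib_left)
  \<comment> \<open>In \<open>HH\<close> the contributions \<open>k * (k - 1) * ?V\<close> cancel,
    so division by \<open>?V\<close> leaves
    \<open>(k - 1) * ?V / real r - k * \<alpha>\<close>.\<close>
  also have "\<dots> = ?V' * (kemeny_constant (random_walk E) - (k - 1))
      - (k - 1) * ((k - 1) * ?V / real r - k * \<alpha>)"
  proof -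
    have K_off: "(\<Sum>j\<in>-U. deg j * hitting_time E j u) = ?V * (kemeny_constant (random_walk E) - (k - 1))"
      using K by (simp add: algebra_simps)
    show ?thesis
      unfolding HH K_off using total_degree_pos r_pos by (simp add: field_simps)
  qed
  finally have "?V' * kemeny_constant (random_walk E') =
      (k - 1) * (real r + k - 1) * ?V' / (real r + k)
      + ?V' * (kemeny_constant (random_walk E) - (k - 1))
      - (k - 1) * ((k - 1) * ?V / real r - k * \<alpha>)"
    using K' by simp
  then have "?V' * (kemeny_constant (random_walk E') - kemeny_constant (random_walk E)) =
      (k - 1) * ?V' * ((real r + k - 1) / (real r + k) - 1) + (k - 1) * (k * \<alpha> - (k - 1) * ?V / real r)"
    by (simp add: algebra_simps)
  also have "(real r + k - 1) / (real r + k) - 1 = - 1 / (real r + k)"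
    using k_ge_1 by (simp add: field_simps)
  also have "k * \<alpha> - (k - 1) * ?V / real r = k * (\<alpha> - ?V * (k - 1) / (k * real r))"
    using k_ge_1 r_pos by (simp add: field_simps)
  finally show ?thesis
    using cliqued.total_degree_pos unfolding \<alpha>_def by (simp add: field_simps)
qed

end

theorem theorem3p5:
  fixes E :: "('v::finite) set set" and U :: "'v set" and u :: 'v
    and n m k r :: nat and \<alpha>\<^sub>1 :: real and T T' :: "real^'v^'v"
  assumes "simple_graph E"
    and "connected_graph E"
    and "E \<noteq> {}"
    and "CARD('v) = n"
    and "card E = m"
    and "independent_set E U"
    and "twin_vertices E U"
    and "card U = k"
    and "\<And>v. v \<in> U \<Longrightarrow> vertex_degree E v = r"
    and "u \<in> U"
    and "T = random_walk E"
    and "\<alpha>\<^sub>1 = accessibility_index T u"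
    and "T' = random_walk (insert_all_edges E U)"
  shows "kemeny_constant T' - kemeny_constant T =
    real k * (real k - 1) / (2 * real m + real k * (real k - 1)) *
      (\<alpha>\<^sub>1 - 2 * real m * (real k - 1) / (real k * real r))
    - (real k - 1) / (real r + real k)"
proof -
  interpret twin_set E U r
    using assms(1-3,6,7,9,10) by unfold_locales auto
  show ?thesis
    using kemeny_constant_insert_all_edges[OF \<open>u \<in> U\<close>] total_degree_eq_card[OF simple]
      total_degree_insert_all_edges assms(5,8,11-13)
    by simp
qed

end
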